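(* Let $n,k$ be integers with $k$ even and $2\le k\le n-1$. Let $I=J\cup\{n\}$ be a paired basis, with reflected basis $I^*=J^*\cup\{n\}$, where $J^*=\{n-1-s:s\in J\}$. Then for every $s\in J$ and every $p\in(0,1)$, $$w_{n-1-s}^{I^*}(1-p)=\frac{p\,(n-s)}{(1-p)(s+1)}\,w_s^I(p).$$ Furthermore, $w_n^I(p)\ge p^n>0$ for every $p\in(0,1)$. In particular, if for a paired basis $I$ one sets $$\mathcal F^{\circ}(I)=\{p\in(0,1): w_s^I(p)\ge 0\text{ for all }s\in I\},$$ then $\mathcal F^{\circ}(I^* )=\{1-p: p\in\mathcal F^{\circ}(I)\}$.
   Context: Fix integers $n,k$ with $k$ even and $2\le k\le n-1$. Paired basis: a set $I=J\cup\{n\}$ where $J=\bigcup_{j=1}^{k/2}\{a_j,a_j+1\}\subseteq\{0,\ldots,n-1\}$ for integers $a_1,\dots,a_{k/2}$ with $a_{j+1}\ge a_j+2$ for $1\le j<k/2$. Thus $|J|=k$ and $|I|=k+1$. Reflection: for such $I=J\cup\{n\}$, put $J^*=\{n-1-s:s\in J\}$ and $I^*=J^*\cup\{n\}$; this is again a paired basis. Basic weights: for a paired basis $I$ and $p\in(0,1)$, $(w_s^I(p))_{s\in I}$ denotes the unique real (possibly signed) solution of the moment equations $$\sum_{s\in I} w_s^I(p)\binom{s}{r}=\binom{n}{r}p^r,\qquad 0\le r\le k.$$ (Uniqueness and existence hold because evaluation on $k+1$ distinct nodes is invertible on polynomials of degree at most $k$.) *)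

theory Defs
  imports Complex_Main
begin

definition paired_core :: "nat \<Rightarrow> nat \<Rightarrow> nat set \<Rightarrow> bool" where
  "paired_core n k J \<longleftrightarrow>
     (\<exists>a :: nat \<Rightarrow> nat.
        (\<forall>j. 1 \<le> j \<and> j < k div 2 \<longrightarrow> a (j + 1) \<ge> a j + 2) \<and>
        J = (\<Union>j\<in>{1..k div 2}. {a j, a j + 1}) \<and>
        J \<subseteq> {0..n - 1})"

definition reflected_core :: "nat \<Rightarrow> nat set \<Rightarrow> nat set" where
  "reflected_core n J = {n - 1 - s | s. s \<in> J}"

definition moment_equations ::
    "nat \<Rightarrow> nat \<Rightarrow> nat set \<Rightarrow> real \<Rightarrow> (nat \<Rightarrow> real) \<Rightarrow> bool" where
  "moment_equations n k I p w \<longleftrightarrow>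
     (\<forall>r. r \<le> k \<longrightarrow>
        (\<Sum>s\<in>I. w s * real (s choose r)) = real (n choose r) * p ^ r)"

text \<open>
  A family of weights indexed by \<open>I\<close> is represented by the function on all natural numbers
  that extends it by 0. The moment equations do not constrain the values outside \<open>I\<close>, so the
  solution is unique only under this convention.
\<close>

definition basic_weight :: "nat \<Rightarrow> nat \<Rightarrow> nat set \<Rightarrow> real \<Rightarrow> nat \<Rightarrow> real" where
  "basic_weight n k I p =
     (THE w. moment_equations n k I p w \<and> (\<forall>s. s \<notin> I \<longrightarrow> w s = 0))"

definition feasible_open :: "nat \<Rightarrow> nat \<Rightarrow> nat set \<Rightarrow> real set" where
  "feasible_open n k I =
     {p. 0 < p \<and> p < 1 \<and> (\<forall>s\<in>I. basic_weight n k I p s \<ge> 0)}"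

end

theory Submission
  imports Defs "HOL-Computational_Algebra.Polynomial"
begin

text \<open>
  Let \<open>X\<close> be binomially distributed with parameters \<open>n\<close> and \<open>p\<close>. Its binomial moments are
  \<open>E (X choose r) = (n choose r) * p ^ r\<close>, so the moment equations say that the signed measure
  \<open>w\<close> on \<open>I\<close> integrates every polynomial of degree at most \<open>k\<close> to the same value as the law of
  \<open>X\<close>. Testing this with the Lagrange basis of \<open>I\<close> gives \<open>w s = E (L s X)\<close>, where \<open>L s\<close> is the
  polynomial of degree \<open>k\<close> that is 1 at \<open>s\<close> and 0 at the other nodes; Lagrange interpolation
  shows that these numbers do solve the equations (\<open>basic_weight_eq_binomial_mean\<close>). All claims
  are then statements about expectations.

  \<^item> For \<open>s\<close> in the core \<open>J\<close>, the node \<open>n\<close> contributes to \<open>L s\<close> the factor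
    \<open>(n - X) / (n - s)\<close>. The identity
    \<open>(n - x) * (n choose x) = n * ((n - 1) choose x)\<close> absorbs \<open>n - X\<close> into the distribution,
    which becomes binomial with parameters \<open>n - 1\<close> and \<open>p\<close> (\<open>basic_weight_core\<close>). What is left,
    the Lagrange basis of \<open>J\<close>, is carried to that of the reflected core by
    \<open>x \<mapsto> n - 1 - x\<close>, and the same map turns the success probability \<open>p\<close> into \<open>1 - p\<close>. So the
    two expectations agree, and only the prefactors \<open>n * (1 - p) / (n - s)\<close> and
    \<open>n * p / (s + 1)\<close> differ (\<open>basic_weight_reflect\<close>).

  \<^item> For \<open>s = n\<close>, the polynomial \<open>L n\<close> is a positive multiple of a product of factors
    \<open>(x - a) * (x - (a + 1))\<close>. No integer lies strictly between \<open>a\<close> and \<open>a + 1\<close>, so each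
    factor is nonnegative at integers, and the single outcome \<open>X = n\<close>, where \<open>L n\<close> is 1,
    already gives \<open>p ^ n\<close> (\<open>basic_weight_top_ge\<close>).

  The two weights in the reflection formula have the same sign, and the weight at \<open>n\<close> is
  positive for \<open>I\<close> and, the reflected core being paired as well, for its reflection. Hence the
  feasible sets correspond under \<open>p \<mapsto> 1 - p\<close>.
\<close>

section \<open>Binomial expectations\<close>

definition binomial_mean :: "nat \<Rightarrow> real \<Rightarrow> (nat \<Rightarrow> real) \<Rightarrow> real" where
  "binomial_mean n p g = (\<Sum>x\<le>n. real (n choose x) * p ^ x * (1 - p) ^ (n - x) * g x)"

lemma binomial_mean_cong:
  assumes "\<And>x. x \<le> n \<Longrightarrow> g x = h x"
  shows "binomial_mean n p g = binomial_mean n p h"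
  using assms by (simp add: binomial_mean_def)

lemma binomial_mean_sum:
  "binomial_mean n p (\<lambda>x. \<Sum>i\<in>A. c i * g i x) = (\<Sum>i\<in>A. c i * binomial_mean n p (g i))"
  unfolding binomial_mean_def sum_distrib_left
  by (subst sum.swap) (simp add: mult_ac)

lemma binomial_mean_cmult: "binomial_mean n p (\<lambda>x. c * g x) = c * binomial_mean n p g"
  by (simp add: binomial_mean_def sum_distrib_left mult_ac)

text \<open>
  Since \<open>(n choose x) * (x choose r) = (n choose r) * ((n - r) choose (x - r))\<close>, the sum is
  \<open>(n choose r) * p ^ r\<close> times the total mass of a binomial distribution with \<open>n - r\<close> trials.
\<close>

lemma binomial_mean_choose:
  "binomial_mean n p (\<lambda>x. real (x choose r)) = real (n choose r) * p ^ r"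
proof (cases "r \<le> n")
  case True
  have "binomial_mean n p (\<lambda>x. real (x choose r)) =
      (\<Sum>x\<in>{r..n}. real (n choose x) * p ^ x * (1 - p) ^ (n - x) * real (x choose r))"
    unfolding binomial_mean_def by (rule sum.mono_neutral_right) auto
  also have "\<dots> = (\<Sum>x\<in>{r..n}. real (n choose r) * p ^ r *
      (real ((n - r) choose (x - r)) * p ^ (x - r) * (1 - p) ^ (n - r - (x - r))))"
  proof (rule sum.cong)
    fix x assume x: "x \<in> {r..n}"
    have choose: "real (n choose x) * real (x choose r) = real (n choose r) * real ((n - r) choose (x - r))"
      using choose_mult[of r x n] x by (simp flip: of_nat_mult)
    have pow: "p ^ x = p ^ r * p ^ (x - r)"
      using x by (simp flip: power_add)
    have diff: "n - r - (x - r) = n - x" using x by simp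
    have "real (n choose x) * p ^ x * (1 - p) ^ (n - x) * real (x choose r) =
      (real (n choose x) * real (x choose r)) * p ^ x * (1 - p) ^ (n - x)"
      by (simp only: mult_ac)
    also have "\<dots> = (real (n choose r) * real ((n - r) choose (x - r))) * (p ^ r * p ^ (x - r)) *
      (1 - p) ^ (n - r - (x - r))"
      by (simp only: choose pow diff)
    finally show "real (n choose x) * p ^ x * (1 - p) ^ (n - x) * real (x choose r) =
      real (n choose r) * p ^ r * (real ((n - r) choose (x - r)) * p ^ (x - r) * (1 - p) ^ (n - r - (x - r)))"
      by (simp only: mult_ac)
  qed simp
  also have "\<dots> = real (n choose r) * p ^ r *
      (\<Sum>y\<le>n - r. real ((n - r) choose y) * p ^ y * (1 - p) ^ (n - r - y))"
    unfolding sum_distrib_left[symmetric]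
    by (rule arg_cong[where f = "(*) _"], rule sum.reindex_bij_witness[of _ "\<lambda>y. y + r" "\<lambda>x. x - r"])
       (use True in auto)
  also have "\<dots> = real (n choose r) * p ^ r"
    using binomial_ring[of p "1 - p" "n - r"] by simp
  finally show ?thesis .
next
  case False
  then show ?thesis by (simp add: binomial_mean_def binomial_eq_0)
qed

text \<open>
  The factor \<open>Suc m - x\<close> kills the outcome \<open>x = Suc m\<close> and removes one failing trial from all
  the others.
\<close>

lemma binomial_mean_absorb:
  "binomial_mean (Suc m) p (\<lambda>x. real (Suc m - x) * h x) = real (Suc m) * (1 - p) * binomial_mean m p h"
proof -
  have "real (Suc m choose x) * p ^ x * (1 - p) ^ (Suc m - x) * (real (Suc m - x) * h x) =
      real (Suc m) * (1 - p) * (real (m choose x) * p ^ x * (1 - p) ^ (m - x) * h x)"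
    if "x \<le> m" for x
  proof -
    have absorb: "real (Suc m - x) * real (Suc m choose x) = real (Suc m) * real (m choose x)"
      using binomial_absorb_comp[of "Suc m" x] by (metis diff_Suc_1 of_nat_mult)
    have pow: "(1 - p) ^ (Suc m - x) = (1 - p) * (1 - p) ^ (m - x)"
      using that by (simp add: Suc_diff_le)
    have "real (Suc m choose x) * p ^ x * (1 - p) ^ (Suc m - x) * (real (Suc m - x) * h x) =
      (real (Suc m - x) * real (Suc m choose x)) * p ^ x * (1 - p) ^ (Suc m - x) * h x"
      by (simp only: mult_ac)
    also have "\<dots> = (real (Suc m) * real (m choose x)) * p ^ x * ((1 - p) * (1 - p) ^ (m - x)) * h x"
      by (simp only: absorb pow)
    finally show ?thesis
      by (simp only: mult_ac)
  qed
  then have "(\<Sum>x\<le>m. real (Suc m choose x) * p ^ x * (1 - p) ^ (Suc m - x) * (real (Suc m - x) * h x)) =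
      (\<Sum>x\<le>m. real (Suc m) * (1 - p) * (real (m choose x) * p ^ x * (1 - p) ^ (m - x) * h x))"
    by (intro sum.cong) (simp_all only: atMost_iff)
  then show ?thesis
    unfolding binomial_mean_def sum_distrib_left sum.atMost_Suc by simp
qed

text \<open>
  Exchange of success and failure.
\<close>

lemma binomial_mean_reflect:
  "binomial_mean m (1 - p) (\<lambda>x. h (m - x)) = binomial_mean m p h"
  unfolding binomial_mean_def
  by (rule sum.reindex_bij_witness[of _ "\<lambda>x. m - x" "\<lambda>x. m - x"])
     (auto simp: binomial_symmetric[symmetric])

lemma binomial_mean_ge_top:
  assumes "0 \<le> p" "p \<le> 1" "\<And>x. x < n \<Longrightarrow> 0 \<le> g x"
  shows "p ^ n * g n \<le> binomial_mean n p g"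
proof -
  have "0 \<le> (\<Sum>x<n. real (n choose x) * p ^ x * (1 - p) ^ (n - x) * g x)"
    using assms by (intro sum_nonneg mult_nonneg_nonneg) auto
  then show ?thesis
    unfolding binomial_mean_def lessThan_Suc_atMost[symmetric] by simp
qed

section \<open>Lagrange interpolation\<close>

definition lagrange_basis :: "nat set \<Rightarrow> nat \<Rightarrow> real poly" where
  "lagrange_basis I s = (\<Prod>t\<in>I - {s}. smult (1 / (real s - real t)) [:- real t, 1:])"

lemma poly_lagrange_basis:
  "poly (lagrange_basis I s) x = (\<Prod>t\<in>I - {s}. (x - real t) / (real s - real t))"
  by (simp add: lagrange_basis_def poly_prod divide_simps)

lemma poly_lagrange_basis_node:
  assumes "finite I" "s \<in> I" "t \<in> I"
  shows "poly (lagrange_basis I s) (real t) = (if t = s then 1 else 0)"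
  using assms by (auto simp: poly_lagrange_basis intro!: prod.neutral prod_zero)

lemma degree_lagrange_basis:
  assumes "finite I" "s \<in> I"
  shows "degree (lagrange_basis I s) < card I"
proof -
  have "degree (lagrange_basis I s) \<le>
      (\<Sum>t\<in>I - {s}. degree (smult (1 / (real s - real t)) [:- real t, 1:]))"
    unfolding lagrange_basis_def using assms by (intro order.trans[OF degree_prod_sum_le]) auto
  also have "\<dots> \<le> (\<Sum>t\<in>I - {s}. 1)"
    by (intro sum_mono) simp
  also have "\<dots> < card I"
    using card_Diff1_less[OF assms] by (simp del: card_Diff_singleton)
  finally show ?thesis .
qed

text \<open>
  Both sides have degree less than the number of nodes and agree at every node.
\<close>

lemma lagrange_interpolation:
  assumes "finite I" "degree f < card I"
  shows "f = (\<Sum>s\<in>I. smult (poly f (real s)) (lagrange_basis I s))"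
proof (rule poly_eqI_degree[where A = "real ` I"])
  have card: "card (real ` I) = card I"
    by (simp add: card_image inj_on_def)
  show "degree f < card (real ` I)"
    using assms card by simp
  show "degree (\<Sum>s\<in>I. smult (poly f (real s)) (lagrange_basis I s)) < card (real ` I)"
    unfolding card using assms degree_lagrange_basis[of I]
    by (intro degree_sum_less) (auto intro: le_less_trans[OF degree_smult_le])
next
  fix x assume "x \<in> real ` I"
  then show "poly f x = poly (\<Sum>s\<in>I. smult (poly f (real s)) (lagrange_basis I s)) x"
    using assms by (auto simp: poly_sum poly_lagrange_basis_node if_distrib cong: if_cong)
qed

lemma poly_lagrange_basis_insert:
  assumes "finite J" "n \<notin> J" "s \<in> J"
  shows "poly (lagrange_basis (insert n J) s) x =
    (x - real n) / (real s - real n) * poly (lagrange_basis J s) x"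
proof -
  have "insert n J - {s} = insert n (J - {s})" using assms by auto
  then show ?thesis using assms by (simp add: poly_lagrange_basis)
qed

text \<open>
  A Lagrange basis depends only on ratios of differences of nodes, and an affine map preserves
  those.
\<close>

lemma poly_lagrange_basis_reflect:
  assumes "J \<subseteq> {..m}" "s \<in> J" "x \<le> m"
  shows "poly (lagrange_basis ((\<lambda>t. m - t) ` J) (m - s)) (real (m - x)) =
    poly (lagrange_basis J s) (real x)"
proof -
  have "(\<Prod>t\<in>(\<lambda>t. m - t) ` J - {m - s}. (real (m - x) - real t) / (real (m - s) - real t)) =
      (\<Prod>t\<in>J - {s}. (real x - real t) / (real s - real t))"
  proof (rule prod.reindex_bij_witness[of _ "\<lambda>t. m - t" "\<lambda>t. m - t"])
    fix t assume "t \<in> (\<lambda>t. m - t) ` J - {m - s}"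
    then obtain u where u: "t = m - u" "u \<in> J" "m - u \<noteq> m - s" by auto
    then have le: "u \<le> m" "s \<le> m" using assms by auto
    show "m - (m - t) = t" "m - t \<in> J - {s}" using u le by auto
    show "(real x - real (m - t)) / (real s - real (m - t)) =
        (real (m - x) - real t) / (real (m - s) - real t)"
      using u le assms by (auto simp: of_nat_diff divide_simps) (simp_all add: algebra_simps)
  next
    fix t assume t: "t \<in> J - {s}"
    then have "t \<le> m" "s \<le> m" using assms by auto
    then show "m - (m - t) = t" "m - t \<in> (\<lambda>t. m - t) ` J - {m - s}" using t by auto
  qed
  then show ?thesis by (simp add: poly_lagrange_basis)
qed

section \<open>Basic weights as expectations\<close>

text \<open>
  The moment equations only test the functions \<open>x choose r\<close>. They reach all polynomials because
  multiplication by \<open>x\<close> keeps the span of these functions and raises the top index by one: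
  \<open>x * (x choose r) = r * (x choose r) + (r + 1) * (x choose (r + 1))\<close>.
\<close>

lemma poly_binomial_expansion:
  fixes f :: "real poly"
  assumes "degree f \<le> d"
  shows "\<exists>c. \<forall>x. poly f (real x) = (\<Sum>r\<le>d. c r * real (x choose r))"
  using assms
proof (induction d arbitrary: f)
  case 0
  then obtain a where "f = [:a:]" by (auto elim: degree_eq_zeroE)
  then show ?case by (intro exI[of _ "\<lambda>_. a"]) simp
next
  case (Suc d)
  obtain a g where f: "f = pCons a g" by (cases f)
  with Suc.prems have "degree g \<le> d" by (auto split: if_splits)
  with Suc.IH obtain c where c: "\<And>x. poly g (real x) = (\<Sum>r\<le>d. c r * real (x choose r))"
    by blast
  (* Coefficients of the two summands of x * (x choose r); those of the second are shifted by
     one index, which leaves index 0 for the constant term a. *)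
  define b where "b r = (if r \<le> d then real r * c r else 0)" for r
  define e where "e r = (case r of 0 \<Rightarrow> a | Suc i \<Rightarrow> real (Suc i) * c i)" for r
  have "poly f (real x) = (\<Sum>r\<le>Suc d. (b r + e r) * real (x choose r))" for x
  proof -
    have "real x * real (x choose r) = real r * real (x choose r) + real (Suc r) * real (x choose Suc r)" for r
      using gbinomial_mult_1[of "real x" r] by (simp only: binomial_gbinomial)
    then have "real x * poly g (real x) =
        (\<Sum>r\<le>d. c r * (real r * real (x choose r) + real (Suc r) * real (x choose Suc r)))"
      unfolding c sum_distrib_left mult.left_commute[of "real x"] by (simp only:)
    also have "\<dots> = (\<Sum>r\<le>d. b r * real (x choose r)) + (\<Sum>r\<le>d. e (Suc r) * real (x choose Suc r))"
      unfolding sum.distrib[symmetric] by (rule sum.cong) (auto simp: b_def e_def algebra_simps)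
    also have "(\<Sum>r\<le>d. b r * real (x choose r)) = (\<Sum>r\<le>Suc d. b r * real (x choose r))"
      by (simp add: b_def)
    also have "(\<Sum>r\<le>d. e (Suc r) * real (x choose Suc r)) = (\<Sum>r\<le>Suc d. e r * real (x choose r)) - a"
      by (simp add: sum.atMost_Suc_shift[of _ d] e_def del: sum.atMost_Suc)
    finally show ?thesis
      by (simp add: f sum.distrib distrib_right del: sum.atMost_Suc)
  qed
  then show ?case by (intro exI[of _ "\<lambda>r. b r + e r"] allI)
qed

lemma moment_equations_poly:
  assumes "moment_equations n k I p w" "degree f \<le> k"
  shows "(\<Sum>s\<in>I. w s * poly f (real s)) = binomial_mean n p (\<lambda>x. poly f (real x))"
proof -
  obtain c where c: "\<And>x. poly f (real x) = (\<Sum>r\<le>k. c r * real (x choose r))"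
    using poly_binomial_expansion[OF assms(2)] by blast
  have "(\<Sum>s\<in>I. w s * poly f (real s)) = (\<Sum>r\<le>k. c r * (\<Sum>s\<in>I. w s * real (s choose r)))"
    unfolding c sum_distrib_left by (subst sum.swap) (simp add: mult_ac)
  also have "\<dots> = (\<Sum>r\<le>k. c r * binomial_mean n p (\<lambda>x. real (x choose r)))"
    using assms(1) by (simp add: moment_equations_def binomial_mean_choose)
  also have "\<dots> = binomial_mean n p (\<lambda>x. poly f (real x))"
    unfolding c binomial_mean_sum ..
  finally show ?thesis .
qed

text \<open>
  Interpolating the polynomial \<open>x choose r\<close> on \<open>I\<close> and taking expectations is exactly the
  \<open>r\<close>-th moment equation for the weights \<open>E (L s X)\<close>.
\<close>

lemma moment_equations_lagrange:
  assumes "finite I" "card I = Suc k"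
  shows "moment_equations n k I p
    (\<lambda>s. if s \<in> I then binomial_mean n p (\<lambda>x. poly (lagrange_basis I s) (real x)) else 0)"
  unfolding moment_equations_def
proof (intro allI impI)
  fix r assume "r \<le> k"
  define B where "B = smult (1 / fact r) (\<Prod>i<r. [:- real i, 1:])"
  have B: "poly B (real x) = real (x choose r)" for x
    by (simp add: B_def poly_prod binomial_gbinomial gbinomial_prod_rev atLeast0LessThan)
  have "degree B \<le> r"
    using degree_prod_sum_le[of "{..<r}" "\<lambda>i. [:- real i, 1:]"] by (simp add: B_def)
  then have "B = (\<Sum>s\<in>I. smult (poly B (real s)) (lagrange_basis I s))"
    using assms \<open>r \<le> k\<close> by (intro lagrange_interpolation) auto
  then have "poly B (real x) = poly (\<Sum>s\<in>I. smult (poly B (real s)) (lagrange_basis I s)) (real x)" for x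
    by (rule arg_cong)
  then have choose: "real (x choose r) = (\<Sum>s\<in>I. real (s choose r) * poly (lagrange_basis I s) (real x))" for x
    unfolding poly_sum poly_smult B .
  have "binomial_mean n p (\<lambda>x. real (x choose r)) =
      binomial_mean n p (\<lambda>x. \<Sum>s\<in>I. real (s choose r) * poly (lagrange_basis I s) (real x))"
    by (intro binomial_mean_cong choose)
  also have "\<dots> =
      (\<Sum>s\<in>I. real (s choose r) * binomial_mean n p (\<lambda>x. poly (lagrange_basis I s) (real x)))"
    by (rule binomial_mean_sum)
  finally show "(\<Sum>s\<in>I. (if s \<in> I then binomial_mean n p (\<lambda>x. poly (lagrange_basis I s) (real x)) else 0)
      * real (s choose r)) = real (n choose r) * p ^ r"
    by (simp add: binomial_mean_choose mult.commute)
qed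

text \<open>
  Any solution of the moment equations, tested with the Lagrange basis polynomial of \<open>t\<close>,
  returns its own weight at \<open>t\<close>. This gives uniqueness, and with it the closed form.
\<close>

lemma basic_weight_eq_binomial_mean:
  assumes "finite I" "card I = Suc k" "s \<in> I"
  shows "basic_weight n k I p s = binomial_mean n p (\<lambda>x. poly (lagrange_basis I s) (real x))"
proof -
  let ?w = "\<lambda>s. if s \<in> I then binomial_mean n p (\<lambda>x. poly (lagrange_basis I s) (real x)) else 0"
  have "basic_weight n k I p = ?w"
    unfolding basic_weight_def
  proof (rule the_equality)
    show "moment_equations n k I p ?w \<and> (\<forall>s. s \<notin> I \<longrightarrow> ?w s = 0)"
      using moment_equations_lagrange[OF assms(1,2)] by simp
  next
    fix w assume w: "moment_equations n k I p w \<and> (\<forall>s. s \<notin> I \<longrightarrow> w s = 0)"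
    have "w t = binomial_mean n p (\<lambda>x. poly (lagrange_basis I t) (real x))" if "t \<in> I" for t
    proof -
      have "degree (lagrange_basis I t) \<le> k"
        using degree_lagrange_basis[OF assms(1) that] assms(2) by simp
      from moment_equations_poly[OF conjunct1[OF w] this]
      have "(\<Sum>s\<in>I. w s * poly (lagrange_basis I t) (real s)) =
        binomial_mean n p (\<lambda>x. poly (lagrange_basis I t) (real x))" .
      moreover have "(\<Sum>s\<in>I. w s * poly (lagrange_basis I t) (real s)) = w t"
        using assms(1) that by (simp add: poly_lagrange_basis_node if_distrib cong: if_cong)
      ultimately show ?thesis by simp
    qed
    then show "w = ?w" using w by auto
  qed
  then show ?thesis using assms(3) by simp
qed

text \<open>
  The weights at the core are expectations with one trial fewer, in which the node \<open>Suc m\<close>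
  survives only in the prefactor. This is the form that is symmetric under reflection.
\<close>

lemma basic_weight_core:
  assumes "J \<subseteq> {..m}" "card J = k" "s \<in> J"
  shows "basic_weight (Suc m) k (insert (Suc m) J) p s =
    real (Suc m) * (1 - p) / (real (Suc m) - real s) *
      binomial_mean m p (\<lambda>x. poly (lagrange_basis J s) (real x))"
proof -
  have J: "finite J" "Suc m \<notin> J" using assms(1) by (auto intro: finite_subset)
  have "basic_weight (Suc m) k (insert (Suc m) J) p s =
      binomial_mean (Suc m) p (\<lambda>x. poly (lagrange_basis (insert (Suc m) J) s) (real x))"
    using assms J by (intro basic_weight_eq_binomial_mean) auto
  also have "\<dots> = binomial_mean (Suc m) p (\<lambda>x. real (Suc m - x) *
      (1 / (real (Suc m) - real s) * poly (lagrange_basis J s) (real x)))"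
  proof (rule binomial_mean_cong)
    fix x assume "x \<le> Suc m"
    moreover have "real s < real (Suc m)" using assms by auto
    ultimately show "poly (lagrange_basis (insert (Suc m) J) s) (real x) =
      real (Suc m - x) * (1 / (real (Suc m) - real s) * poly (lagrange_basis J s) (real x))"
      unfolding poly_lagrange_basis_insert[OF J assms(3)]
      by (simp add: of_nat_diff divide_simps del: of_nat_Suc) (simp add: algebra_simps del: of_nat_Suc)
  qed
  finally show ?thesis
    unfolding binomial_mean_absorb binomial_mean_cmult by simp
qed

text \<open>
  The two expectations in \<open>basic_weight_core\<close> coincide, so the factor is the quotient of the
  prefactors \<open>p / (s + 1)\<close> and \<open>(1 - p) / (Suc m - s)\<close>; the cutoff of subtraction at 0 is never
  reached, since the core lies in \<open>{..m}\<close>.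
\<close>

lemma basic_weight_reflect:
  assumes "J \<subseteq> {..m}" "card J = k" "s \<in> J" "p \<noteq> 1"
  shows "basic_weight (Suc m) k (insert (Suc m) ((\<lambda>t. m - t) ` J)) (1 - p) (m - s) =
    p * (real (Suc m) - real s) / ((1 - p) * (real s + 1)) *
      basic_weight (Suc m) k (insert (Suc m) J) p s"
proof -
  let ?J' = "(\<lambda>t. m - t) ` J"
  let ?E = "binomial_mean m p (\<lambda>x. poly (lagrange_basis J s) (real x))"
  have "inj_on (\<lambda>t. m - t) J"
    using assms(1) by (metis atMost_iff diff_diff_cancel inj_onI subsetD)
  then have "card ?J' = k" using assms(2) by (simp add: card_image)
  then have "basic_weight (Suc m) k (insert (Suc m) ?J') (1 - p) (m - s) =
      real (Suc m) * p / (real (Suc m) - real (m - s)) *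
      binomial_mean m (1 - p) (\<lambda>x. poly (lagrange_basis ?J' (m - s)) (real x))"
    using basic_weight_core[of ?J' m k "m - s" "1 - p"] assms(3) by (simp add: image_subset_iff)
  also have "binomial_mean m (1 - p) (\<lambda>x. poly (lagrange_basis ?J' (m - s)) (real x)) =
      binomial_mean m (1 - p) (\<lambda>x. poly (lagrange_basis J s) (real (m - x)))"
    using poly_lagrange_basis_reflect[OF assms(1,3), of "m - x" for x]
    by (intro binomial_mean_cong) (metis diff_diff_cancel diff_le_self)
  also have "\<dots> = ?E"
    by (rule binomial_mean_reflect)
  finally have w': "basic_weight (Suc m) k (insert (Suc m) ?J') (1 - p) (m - s) =
      real (Suc m) * p / (real (Suc m) - real (m - s)) * ?E" .
  have "s \<le> m" using assms by auto
  then have "real (Suc m) - real (m - s) = real s + 1" "real (Suc m) - real s > 0"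
    by (auto simp: of_nat_diff)
  then show ?thesis
    unfolding w' basic_weight_core[OF assms(1-3)] using assms(4)
    by (simp add: divide_simps del: of_nat_Suc)
qed

section \<open>Paired cores\<close>

lemma paired_core_gap:
  fixes a :: "nat \<Rightarrow> nat"
  assumes "\<And>j. 1 \<le> j \<Longrightarrow> j < h \<Longrightarrow> a j + 2 \<le> a (j + 1)" "1 \<le> i" "i < j" "j \<le> h"
  shows "a i + 2 \<le> a j"
  using assms(3,4)
proof (induction j)
  case (Suc j)
  then show ?case using assms(1)[of j] assms(2) by (cases "i = j") auto
qed simp

text \<open>
  The gap condition makes the pairs disjoint, so products over the core may be taken pair by
  pair.
\<close>

lemma paired_core_prod:
  fixes g :: "nat \<Rightarrow> 'a :: comm_monoid_mult" and a :: "nat \<Rightarrow> nat"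
  assumes gap: "\<And>j. 1 \<le> j \<Longrightarrow> j < h \<Longrightarrow> a j + 2 \<le> a (j + 1)"
  shows "(\<Prod>s\<in>(\<Union>j\<in>{1..h}. {a j, a j + 1}). g s) = (\<Prod>j\<in>{1..h}. g (a j) * g (a j + 1))"
proof -
  have "{a i, a i + 1} \<inter> {a j, a j + 1} = {}" if "i \<in> {1..h}" "j \<in> {1..h}" "i \<noteq> j" for i j
    using paired_core_gap[of h a i j, OF gap] paired_core_gap[of h a j i, OF gap] that
    by (cases "i < j") auto
  then have "(\<Prod>s\<in>(\<Union>j\<in>{1..h}. {a j, a j + 1}). g s) = (\<Prod>j\<in>{1..h}. \<Prod>s\<in>{a j, a j + 1}. g s)"
    by (intro prod.UNION_disjoint) auto
  then show ?thesis by simp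
qed

lemma paired_core_card:
  assumes "paired_core n k J" "even k"
  shows "card J = k"
proof -
  obtain a where gap: "\<And>j. 1 \<le> j \<Longrightarrow> j < k div 2 \<Longrightarrow> a j + 2 \<le> a (j + 1)"
    and J: "J = (\<Union>j\<in>{1..k div 2}. {a j, a j + 1})"
    using assms(1) unfolding paired_core_def by blast
  (* The cardinality is read off from the product of the constant 2. *)
  have "(2::nat) ^ card J = (\<Prod>s\<in>J. 2)" by simp
  also have "\<dots> = 4 ^ (k div 2)"
    unfolding J by (subst paired_core_prod[where a = a, OF gap]) simp_all
  also have "\<dots> = (2 ^ 2) ^ (k div 2)" by simp
  also have "\<dots> = 2 ^ k"
    using assms(2) by (simp only: dvd_mult_div_cancel flip: power_mult)
  finally show ?thesis by simp
qed

text \<open>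
  Both factors of \<open>(x - b) * (x - (b + 1))\<close> are nonpositive if \<open>x \<le> b\<close> and nonnegative
  otherwise; here it matters that \<open>x\<close> is an integer.
\<close>

lemma paired_core_prod_nonneg:
  assumes "paired_core n k J"
  shows "0 \<le> (\<Prod>t\<in>J. real x - real t)"
proof -
  obtain a where gap: "\<And>j. 1 \<le> j \<Longrightarrow> j < k div 2 \<Longrightarrow> a j + 2 \<le> a (j + 1)"
    and J: "J = (\<Union>j\<in>{1..k div 2}. {a j, a j + 1})"
    using assms unfolding paired_core_def by blast
  have "0 \<le> (real x - real b) * (real x - real (b + 1))" for b
    by (cases "x \<le> b") (auto intro: mult_nonpos_nonpos)
  then show ?thesis
    unfolding J by (subst paired_core_prod[where a = a, OF gap]) (auto intro!: prod_nonneg)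
qed

lemma reflected_core_conv_image: "reflected_core n J = (\<lambda>s. n - 1 - s) ` J"
  by (auto simp: reflected_core_def)

text \<open>
  Reflection maps the pair \<open>{c, c + 1}\<close> to \<open>{n - 2 - c, n - 2 - c + 1}\<close> and reverses the order
  of the pairs.
\<close>

lemma paired_core_reflect:
  assumes "paired_core n k J"
  shows "paired_core n k (reflected_core n J)"
proof -
  define h where "h = k div 2"
  obtain a where gap: "\<And>j. 1 \<le> j \<Longrightarrow> j < h \<Longrightarrow> a j + 2 \<le> a (j + 1)"
    and J: "J = (\<Union>j\<in>{1..h}. {a j, a j + 1})" and sub: "J \<subseteq> {0..n - 1}"
    using assms unfolding paired_core_def h_def by blast
  have le: "a j + 1 \<le> n - 1" if "j \<in> {1..h}" for j
  proof -
    have "a j + 1 \<in> J" unfolding J using that by blast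
    then show ?thesis using sub by auto
  qed
  define b where "b j = n - 2 - a (h + 1 - j)" for j
  have "b j + 2 \<le> b (j + 1)" if "1 \<le> j" "j < h" for j
  proof -
    have "a (h - j) + 2 \<le> a (h - j + 1)" using gap[of "h - j"] that by auto
    moreover have "a (h - j + 1) + 1 \<le> n - 1" using le[of "h - j + 1"] that by auto
    moreover have "b j = n - 2 - a (h - j + 1)" "b (j + 1) = n - 2 - a (h - j)"
      using that by (simp_all add: b_def Suc_diff_le)
    ultimately show ?thesis by linarith
  qed
  moreover have "reflected_core n J = (\<Union>j\<in>{1..h}. {b j, b j + 1})"
  proof -
    have "reflected_core n J = (\<Union>j\<in>{1..h}. {n - 1 - a j, n - 1 - (a j + 1)})"
      by (simp add: reflected_core_conv_image J image_UN)
    also have "\<dots> = (\<Union>j\<in>{1..h}. {n - 2 - a j, n - 2 - a j + 1})"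
      (* The last position n - 1 bounds every a j + 1, so that no subtraction is cut off at 0. *)
    proof (rule SUP_cong)
      fix j assume "j \<in> {1..h}"
      then have "n - 1 - a j = n - 2 - a j + 1" "n - 1 - (a j + 1) = n - 2 - a j"
        using le[of j] by auto
      then show "{n - 1 - a j, n - 1 - (a j + 1)} = {n - 2 - a j, n - 2 - a j + 1}"
        by (simp only: insert_commute)
    qed simp
    also have "\<dots> = (\<Union>j\<in>(\<lambda>j. h + 1 - j) ` {1..h}. {n - 2 - a j, n - 2 - a j + 1})"
    proof -
      have "(\<lambda>j. h + 1 - j) ` {1..h} = {1..h}"
      proof (intro equalityI subsetI)
        fix j assume "j \<in> {1..h}"
        then show "j \<in> (\<lambda>j. h + 1 - j) ` {1..h}"
          by (intro image_eqI[of _ _ "h + 1 - j"]) auto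
      qed auto
      then show ?thesis by simp
    qed
    finally show ?thesis by (simp add: b_def)
  qed
  moreover have "reflected_core n J \<subseteq> {0..n - 1}"
    by (auto simp: reflected_core_def)
  ultimately show ?thesis unfolding paired_core_def h_def by blast
qed

text \<open>
  The Lagrange polynomial of the node \<open>n\<close> is nonnegative at all integers and equals 1 at \<open>n\<close>,
  an outcome of probability \<open>p ^ n\<close>.
\<close>

lemma basic_weight_top_ge:
  assumes "paired_core n k J" "even k" "0 < n" "0 \<le> p" "p \<le> 1"
  shows "p ^ n \<le> basic_weight n k (J \<union> {n}) p n"
proof -
  have sub: "J \<subseteq> {0..n - 1}" using assms(1) by (auto simp: paired_core_def)
  then have J: "finite J" "n \<notin> J" "\<And>t. t \<in> J \<Longrightarrow> t < n"
    using assms(3) by (auto intro: finite_subset)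
  let ?L = "\<lambda>x. poly (lagrange_basis (J \<union> {n}) n) (real x)"
  have "J \<union> {n} - {n} = J" using J by auto
  then have "?L x = (\<Prod>t\<in>J. real x - real t) / (\<Prod>t\<in>J. real n - real t)" for x
    by (simp add: poly_lagrange_basis prod_dividef)
  moreover have "0 < (\<Prod>t\<in>J. real n - real t)"
    using J(3) by (intro prod_pos) auto
  ultimately have "0 \<le> ?L x" for x
    using paired_core_prod_nonneg[OF assms(1)] by simp
  moreover have "?L n = 1" using J by (subst poly_lagrange_basis_node) auto
  ultimately have "p ^ n \<le> binomial_mean n p ?L"
    using binomial_mean_ge_top[of p n ?L] assms by simp
  then show ?thesis
    using paired_core_card[OF assms(1,2)] J by (subst basic_weight_eq_binomial_mean) auto
qed

section \<open>Reflection of feasible sets\<close>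

theorem theorem1:
  fixes n k :: nat and J I Istar :: "nat set"
  assumes "even k" and "2 \<le> k" and "k \<le> n - 1"
    and "paired_core n k J"
    and "I = J \<union> {n}"
    and "Istar = reflected_core n J \<union> {n}"
  shows "(\<forall>s\<in>J. \<forall>p::real. 0 < p \<and> p < 1 \<longrightarrow>
            basic_weight n k Istar (1 - p) (n - 1 - s)
              = (p * (real n - real s)) / ((1 - p) * (real s + 1)) * basic_weight n k I p s)
       \<and> (\<forall>p::real. 0 < p \<and> p < 1 \<longrightarrow>
            basic_weight n k I p n \<ge> p ^ n \<and> p ^ n > 0)
       \<and> feasible_open n k Istar = {1 - p | p. p \<in> feasible_open n k I}"
proof -
  obtain m where n: "n = Suc m" using assms(2,3) by (cases n) auto
  have sub: "J \<subseteq> {..m}" using assms(4) by (auto simp: paired_core_def n)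
  have weights: "basic_weight n k Istar (1 - p) (n - 1 - s)
      = (p * (real n - real s)) / ((1 - p) * (real s + 1)) * basic_weight n k I p s"
    if "s \<in> J" "0 < p" "p < 1" for s p
    using basic_weight_reflect[OF sub paired_core_card[OF assms(4,1)] that(1), of p] that
    by (simp add: assms(5,6) n reflected_core_conv_image)
  have top: "p ^ n \<le> basic_weight n k I p n" "0 < p ^ n" if "0 < p" "p < 1" for p
    using basic_weight_top_ge[OF assms(4,1), of p] that by (auto simp: n assms(5))
  have top': "0 \<le> basic_weight n k Istar p n" if "0 < p" "p < 1" for p
  proof -
    have "0 \<le> p ^ n" using that by simp
    also have "\<dots> \<le> basic_weight n k Istar p n"
      using basic_weight_top_ge[OF paired_core_reflect[OF assms(4)] assms(1), of p] that
      by (simp add: n assms(6))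
    finally show ?thesis .
  qed
  have feas: "1 - p \<in> feasible_open n k Istar \<longleftrightarrow> p \<in> feasible_open n k I" for p
  proof (cases "0 < p \<and> p < 1")
    case True
    have core: "0 \<le> basic_weight n k Istar (1 - p) (n - 1 - s) \<longleftrightarrow> 0 \<le> basic_weight n k I p s"
      if "s \<in> J" for s
    proof -
      let ?c = "(p * (real n - real s)) / ((1 - p) * (real s + 1))"
      have "0 < ?c"
        using True that sub by (auto simp: n intro!: divide_pos_pos mult_pos_pos)
      then have "0 \<le> ?c * basic_weight n k I p s \<longleftrightarrow> 0 \<le> basic_weight n k I p s"
        by (meson linorder_not_less mult_nonneg_nonneg mult_pos_neg order_less_imp_le)
      then show ?thesis
        using weights[OF that, of p] True by simp
    qed
    have "1 - p \<in> feasible_open n k Istar \<longleftrightarrow>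
        (\<forall>s\<in>J. 0 \<le> basic_weight n k Istar (1 - p) (n - 1 - s))"
      using True top'[of "1 - p"] unfolding feasible_open_def assms(6) reflected_core_conv_image
      by simp
    also have "\<dots> \<longleftrightarrow> (\<forall>s\<in>J. 0 \<le> basic_weight n k I p s)"
      using core by (rule ball_cong[OF refl])
    also have "\<dots> \<longleftrightarrow> p \<in> feasible_open n k I"
      using True less_imp_le[OF less_le_trans[OF top(2) top(1)], of p]
      unfolding feasible_open_def assms(5) by simp
    finally show ?thesis .
  next
    case False
    then show ?thesis by (auto simp: feasible_open_def)
  qed
  have "feasible_open n k Istar = {1 - p | p. p \<in> feasible_open n k I}"
  proof (intro equalityI subsetI)
    fix q assume "q \<in> feasible_open n k Istar"
    then have "1 - q \<in> feasible_open n k I"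
      using feas[of "1 - q"] by simp
    then show "q \<in> {1 - p | p. p \<in> feasible_open n k I}"
      by (intro CollectI exI[of _ "1 - q"]) simp
  next
    fix q assume "q \<in> {1 - p | p. p \<in> feasible_open n k I}"
    then obtain p where "q = 1 - p" "p \<in> feasible_open n k I" by blast
    then show "q \<in> feasible_open n k Istar" by (simp only: feas)
  qed
  moreover have "\<forall>s\<in>J. \<forall>p::real. 0 < p \<and> p < 1 \<longrightarrow>
      basic_weight n k Istar (1 - p) (n - 1 - s)
        = (p * (real n - real s)) / ((1 - p) * (real s + 1)) * basic_weight n k I p s"
    using weights by blast
  moreover have "\<forall>p::real. 0 < p \<and> p < 1 \<longrightarrow> basic_weight n k I p n \<ge> p ^ n \<and> p ^ n > 0"
    using top by blast
  ultimately show ?thesis by (intro conjI)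
qed

end
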